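(* Let $C\subseteq\mathbb{R}^n$ be a nonempty convex compact set, let $f:C\times C\to\mathbb{R}$ satisfy $f(x,x)=0$ for all $x\in C$, and let $K:C\rightrightarrows C$ be a set-valued map. Define $F:C\rightrightarrows C$ by $F(x):=\{y\in C: f(x,y)<0\}$. Assume that $K$ is lower semicontinuous with nonempty convex values and that $\operatorname{fix}K$ is closed. Moreover suppose that (i) $F(x)$ is convex for every $x\in\operatorname{fix}K$; (ii) $F$ is lower semicontinuous on $\operatorname{fix}K$; (iii) the map $F\cap K: x\mapsto F(x)\cap K(x)$ is lower semicontinuous on $\partial_C\operatorname{fix}K$. Then the quasiequilibrium problem has a solution, i.e. there exists $x\in C$ such that $x\in K(x)$ and $f(x,y)\ge 0$ for all $y\in K(x)$.
   Context: A set-valued map $\Phi:X\rightrightarrows Y$ between topological spaces assigns to each $x\in X$ a (possibly empty) subset $\Phi(x)\subseteq Y$. It is lower semicontinuous at $x$ if for each open set $\Omega$ with $\Phi(x)\cap\Omega\neq\emptyset$ there is a neighborhood $U_x$ of $x$ such that $\Phi(x')\cap\Omega\neq\emptyset$ for all $x'\in U_x$; it is lower semicontinuous if it is so at every point. "Lower semicontinuous on $S$", for $S\subseteq X$, means that the restriction of the map to $S$ (with the relative topology on $S$) is lower semicontinuous. $\operatorname{fix}K:=\{x\in C: x\in K(x)\}$. For $A\subseteq C$, $\operatorname{int}_CA$ and $\operatorname{cl}_CA$ are the interior and closure of $A$ in the relative topology of $C$, and $\partial_CA:=\operatorname{cl}_CA\setminus\operatorname{int}_CA$. *)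

theory Defs
  imports "HOL-Analysis.Analysis"
begin

text \<open>A set-valued map between topological spaces is a function into sets; it is only evaluated on
  the carrier of its domain space. Values may be empty.\<close>

definition lsc_at :: "'a topology \<Rightarrow> 'b topology \<Rightarrow> ('a \<Rightarrow> 'b set) \<Rightarrow> 'a \<Rightarrow> bool" where
  "lsc_at X Y \<Phi> x \<longleftrightarrow>
     (\<forall>\<Omega>. openin Y \<Omega> \<and> \<Phi> x \<inter> \<Omega> \<noteq> {} \<longrightarrow>
       (\<exists>U. openin X U \<and> x \<in> U \<and> (\<forall>x'\<in>U. \<Phi> x' \<inter> \<Omega> \<noteq> {})))"

definition lsc_map :: "'a topology \<Rightarrow> 'b topology \<Rightarrow> ('a \<Rightarrow> 'b set) \<Rightarrow> bool" where
  "lsc_map X Y \<Phi> \<longleftrightarrow> (\<forall>x\<in>topspace X. lsc_at X Y \<Phi> x)"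

definition lsc_map_on :: "'a topology \<Rightarrow> 'b topology \<Rightarrow> ('a \<Rightarrow> 'b set) \<Rightarrow> 'a set \<Rightarrow> bool" where
  "lsc_map_on X Y \<Phi> S \<longleftrightarrow> lsc_map (subtopology X S) Y \<Phi>"

definition fix_set :: "'a set \<Rightarrow> ('a \<Rightarrow> 'a set) \<Rightarrow> 'a set" where
  "fix_set C K = {x \<in> C. x \<in> K x}"

definition neg_set :: "'a set \<Rightarrow> ('a \<Rightarrow> 'a \<Rightarrow> real) \<Rightarrow> 'a \<Rightarrow> 'a set" where
  "neg_set C f x = {y \<in> C. f x y < 0}"

end

theory Submission
  imports Defs
begin

text \<open>Suppose there is no solution. Let \<open>G\<close> be \<open>F\<close> on the relative interior of \<open>fix K\<close>,
  \<open>F \<inter> K\<close> on its relative boundary and \<open>K\<close> off \<open>fix K\<close>. Then \<open>G\<close> is lower semicontinuous with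
  nonempty convex values and has no fixed point: \<open>f x x = 0\<close> excludes \<open>x \<in> F x\<close> on \<open>fix K\<close>. This
  contradicts Brouwer's theorem once \<open>G\<close> has a continuous selection. The values of \<open>G\<close> need not be
  closed, so Michael's theorem only gives selections of their closures; but there are countably
  many of these, pointwise dense, and an average of them with positive weights lies in the relative
  interior of the value, because no supporting hyperplane can contain all of them.\<close>

section \<open>Lower semicontinuity in metric terms, and operations that preserve it\<close>

text \<open>Since the values lie in \<open>C\<close>, a ball of the ambient space meets them exactly
  when its trace on \<open>C\<close> does. The right-hand side does not mention \<open>C\<close>, so
  the codomain \<open>C\<close> can be exchanged for the whole space.\<close>

lemma lsc_map_top_of_set_iff:
  fixes \<Phi> :: "'a::metric_space \<Rightarrow> 'b::metric_space set"
  assumes sub: "\<And>x. x \<in> S \<Longrightarrow> \<Phi> x \<subseteq> C"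
  shows "lsc_map (top_of_set S) (top_of_set C) \<Phi> \<longleftrightarrow>
    (\<forall>x\<in>S. \<forall>y\<in>\<Phi> x. \<forall>e>0. \<exists>d>0. \<forall>x'\<in>S. dist x' x < d \<longrightarrow> (\<exists>y'\<in>\<Phi> x'. dist y' y < e))"
    (is "?L \<longleftrightarrow> ?R")
proof
  assume L: ?L
  show ?R
  proof (intro ballI allI impI)
    fix x y and e :: real
    assume x: "x \<in> S" and y: "y \<in> \<Phi> x" and e: "e > 0"
    have "openin (top_of_set C) (C \<inter> ball y e)" "\<Phi> x \<inter> (C \<inter> ball y e) \<noteq> {}"
      using sub[OF x] y e by (auto intro: openin_open_Int)
    with L x obtain U where U: "openin (top_of_set S) U" "x \<in> U"
        "\<forall>x'\<in>U. \<Phi> x' \<inter> (C \<inter> ball y e) \<noteq> {}"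
      unfolding lsc_map_def lsc_at_def by (metis topspace_euclidean_subtopology)
    then obtain d where "d > 0" "\<forall>x'\<in>S. dist x' x < d \<longrightarrow> x' \<in> U"
      unfolding openin_euclidean_subtopology_iff by blast
    with U(3) show "\<exists>d>0. \<forall>x'\<in>S. dist x' x < d \<longrightarrow> (\<exists>y'\<in>\<Phi> x'. dist y' y < e)"
      by (metis Int_iff dist_commute ex_in_conv mem_ball)
  qed
next
  assume R: ?R
  show ?L
    unfolding lsc_map_def lsc_at_def topspace_euclidean_subtopology
  proof (intro ballI allI impI)
    fix x \<Omega>
    assume x: "x \<in> S" and \<Omega>: "openin (top_of_set C) \<Omega> \<and> \<Phi> x \<inter> \<Omega> \<noteq> {}"
    then obtain y where y: "y \<in> \<Phi> x" "y \<in> \<Omega>" by blast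
    then obtain e where e: "e > 0" "\<forall>y'\<in>C. dist y' y < e \<longrightarrow> y' \<in> \<Omega>"
      using \<Omega> unfolding openin_euclidean_subtopology_iff by blast
    then obtain d where d: "d > 0" "\<forall>x'\<in>S. dist x' x < d \<longrightarrow> (\<exists>y'\<in>\<Phi> x'. dist y' y < e)"
      using R x y by blast
    have "\<forall>x'\<in>S \<inter> ball x d. \<Phi> x' \<inter> \<Omega> \<noteq> {}"
    proof
      fix x' assume x': "x' \<in> S \<inter> ball x d"
      then obtain y' where "y' \<in> \<Phi> x'" "dist y' y < e"
        using d by (auto simp: dist_commute)
      then show "\<Phi> x' \<inter> \<Omega> \<noteq> {}" using sub x' e by blast
    qed
    then show "\<exists>U. openin (top_of_set S) U \<and> x \<in> U \<and> (\<forall>x'\<in>U. \<Phi> x' \<inter> \<Omega> \<noteq> {})"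
      using x d by (intro exI[of _ "S \<inter> ball x d"]) (auto intro: openin_open_Int)
  qed
qed

lemma lsc_map_iff:
  fixes \<Phi> :: "'a::metric_space \<Rightarrow> 'b::metric_space set"
  shows "lsc_map (top_of_set S) euclidean \<Phi> \<longleftrightarrow>
    (\<forall>x\<in>S. \<forall>y\<in>\<Phi> x. \<forall>e>0. \<exists>d>0. \<forall>x'\<in>S. dist x' x < d \<longrightarrow> (\<exists>y'\<in>\<Phi> x'. dist y' y < e))"
  using lsc_map_top_of_set_iff[of S \<Phi> UNIV] by simp

lemma lsc_mapD:
  fixes \<Phi> :: "'a::metric_space \<Rightarrow> 'b::metric_space set"
  assumes "lsc_map (top_of_set S) euclidean \<Phi>" "x \<in> S" "y \<in> \<Phi> x" "e > 0"
  shows "\<exists>d>0. \<forall>x'\<in>S. dist x' x < d \<longrightarrow> (\<exists>y'\<in>\<Phi> x'. dist y' y < e)"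
  using assms unfolding lsc_map_iff by blast

lemma lsc_map_subset:
  fixes \<Phi> :: "'a::metric_space \<Rightarrow> 'b::metric_space set"
  assumes "lsc_map (top_of_set S) euclidean \<Phi>" "T \<subseteq> S"
  shows "lsc_map (top_of_set T) euclidean \<Phi>"
  using assms unfolding lsc_map_iff by (meson subsetD)

text \<open>The ball is open, so a point \<open>y\<close> of the intersection has positive slack
  \<open>r - dist (g x) y\<close>, which absorbs small moves of both the centre and the
  point.\<close>

lemma lsc_map_Int_ball:
  fixes \<Phi> :: "'a::metric_space \<Rightarrow> 'b::metric_space set"
  assumes lsc: "lsc_map (top_of_set S) euclidean \<Phi>" and g: "continuous_on S g"
  shows "lsc_map (top_of_set S) euclidean (\<lambda>x. \<Phi> x \<inter> ball (g x) r)"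
  unfolding lsc_map_iff
proof (intro ballI allI impI)
  fix x y and e :: real
  assume x: "x \<in> S" and y: "y \<in> \<Phi> x \<inter> ball (g x) r" and e: "e > 0"
  \<comment> \<open>One half of the slack pays for the move of the centre, the other for the move of
    \<open>y\<close>.\<close>
  define s where "s = (r - dist (g x) y) / 2"
  have s: "s > 0" using y by (simp add: s_def)
  obtain d1 where d1: "d1 > 0" "\<And>x'. x' \<in> S \<Longrightarrow> dist x' x < d1 \<Longrightarrow> \<exists>y'\<in>\<Phi> x'. dist y' y < min e s"
    using lsc_mapD[OF lsc x, of y "min e s"] y e s by auto
  obtain d2 where d2: "d2 > 0" "\<And>x'. x' \<in> S \<Longrightarrow> dist x' x < d2 \<Longrightarrow> dist (g x') (g x) < s"
    using g x s unfolding continuous_on_iff by meson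
  show "\<exists>d>0. \<forall>x'\<in>S. dist x' x < d \<longrightarrow> (\<exists>y'\<in>\<Phi> x' \<inter> ball (g x') r. dist y' y < e)"
  proof (intro exI conjI ballI impI)
    show "min d1 d2 > 0" using d1 d2 by simp
    fix x' assume x': "x' \<in> S" "dist x' x < min d1 d2"
    then obtain y' where y': "y' \<in> \<Phi> x'" "dist y' y < min e s" using d1(2)[of x'] by auto
    have "dist (g x') y' \<le> dist (g x') (g x) + dist (g x) y + dist y' y"
      using dist_triangle[of "g x'" y' "g x"] dist_triangle2[of "g x" y' y] by linarith
    also have "\<dots> < s + dist (g x) y + s"
      using d2(2)[of x'] x' y' by auto
    finally have "dist (g x') y' < r" by (simp add: s_def field_simps)
    then show "\<exists>y'\<in>\<Phi> x' \<inter> ball (g x') r. dist y' y < e" using y' by auto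
  qed
qed

text \<open>Where \<open>A\<close> and \<open>S - A\<close> both accumulate, a value in
  \<open>\<Psi> x\<close> also belongs to \<open>\<Phi> x\<close> and can be followed into either
  piece. At a point at positive distance from one piece, that piece imposes no condition.\<close>

lemma lsc_map_If_closed:
  fixes \<Phi> \<Psi> :: "'a::metric_space \<Rightarrow> 'b::metric_space set"
  assumes \<Phi>: "lsc_map (top_of_set S) euclidean \<Phi>"
    and \<Psi>: "lsc_map (top_of_set A) euclidean \<Psi>"
    and A: "closed A"
    and sub: "\<And>x. x \<in> A \<Longrightarrow> x \<in> closure (S - A) \<Longrightarrow> \<Psi> x \<subseteq> \<Phi> x"
  shows "lsc_map (top_of_set S) euclidean (\<lambda>x. if x \<in> A then \<Psi> x else \<Phi> x)"
  unfolding lsc_map_iff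
proof (intro ballI allI impI)
  fix x y and e :: real
  let ?G = "\<lambda>x. if x \<in> A then \<Psi> x else \<Phi> x"
  assume x: "x \<in> S" and y: "y \<in> ?G x" and e: "e > 0"
  have near_A: "\<exists>d>0. \<forall>x'\<in>A. dist x' x < d \<longrightarrow> (\<exists>y'\<in>?G x'. dist y' y < e)"
  proof (cases "x \<in> A")
    case True
    then show ?thesis using lsc_mapD[OF \<Psi> True, of y e] y e by auto
  next
    case False
    then obtain d where "d > 0" "ball x d \<subseteq> - A"
      using A open_contains_ball[of "- A"] by auto
    then show ?thesis by (intro exI[of _ d]) (auto simp: subset_iff dist_commute)
  qed
  have near_compl: "\<exists>d>0. \<forall>x'\<in>S - A. dist x' x < d \<longrightarrow> (\<exists>y'\<in>?G x'. dist y' y < e)"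
  proof (cases "x \<in> closure (S - A)")
    case True
    then have "y \<in> \<Phi> x" using sub y by (auto split: if_splits)
    then show ?thesis using lsc_mapD[OF \<Phi> x _ e, of y] by auto
  next
    case False
    then show ?thesis by (auto simp: closure_approachable)
  qed
  from near_A near_compl obtain d1 d2 where
    "d1 > 0" "\<forall>x'\<in>A. dist x' x < d1 \<longrightarrow> (\<exists>y'\<in>?G x'. dist y' y < e)"
    "d2 > 0" "\<forall>x'\<in>S - A. dist x' x < d2 \<longrightarrow> (\<exists>y'\<in>?G x'. dist y' y < e)"
    by blast
  then show "\<exists>d>0. \<forall>x'\<in>S. dist x' x < d \<longrightarrow> (\<exists>y'\<in>?G x'. dist y' y < e)"
    by (intro exI[of _ "min d1 d2"]) auto
qed

section \<open>Continuous selections up to an error, and of the closures\<close>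

text \<open>A constant \<open>y t\<close> is within \<open>e\<close> of all values near
  \<open>t\<close>. A partition of unity blends finitely many such constants, and the
  \<open>e\<close>-neighbourhood of a convex value is convex, so the blend stays in it.\<close>

lemma approximate_selection:
  fixes \<Phi> :: "'a::metric_space \<Rightarrow> 'b::real_normed_vector set"
  assumes S: "compact S" and lsc: "lsc_map (top_of_set S) euclidean \<Phi>"
    and conv: "\<And>x. x \<in> S \<Longrightarrow> convex (\<Phi> x)" and ne: "\<And>x. x \<in> S \<Longrightarrow> \<Phi> x \<noteq> {}"
    and e: "e > 0"
  obtains g where "continuous_on S g" "\<And>x. x \<in> S \<Longrightarrow> \<exists>y\<in>\<Phi> x. dist (g x) y < e"
proof -
  have "\<exists>y d. d > 0 \<and> (\<forall>x'\<in>S. dist x' x < d \<longrightarrow> (\<exists>y'\<in>\<Phi> x'. dist y' y < e))" if x: "x \<in> S" for x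
  proof -
    obtain y where "y \<in> \<Phi> x" using ne[OF x] by blast
    from lsc_mapD[OF lsc x this e] show ?thesis by blast
  qed
  then obtain y d where d: "\<And>x. x \<in> S \<Longrightarrow> d x > 0"
    and yd: "\<And>x x'. x \<in> S \<Longrightarrow> x' \<in> S \<Longrightarrow> dist x' x < d x \<Longrightarrow> \<exists>y'\<in>\<Phi> x'. dist y' (y x) < e"
    by metis
  obtain T where T: "T \<subseteq> S" "finite T" "S \<subseteq> (\<Union>t\<in>T. ball t (d t))"
    by (rule compactE_image[OF S, of S "\<lambda>t. ball t (d t)"]) (use d in \<open>auto intro!: bexI\<close>)
  \<comment> \<open>Tent functions, positive on \<open>S\<close> exactly where \<open>t\<close> is
    close enough for \<open>y t\<close> to serve.\<close>
  define w where "w t x = max 0 (d t - dist x t)" for t x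
  define W where "W x = (\<Sum>t\<in>T. w t x)" for x
  define g where "g x = (\<Sum>t\<in>T. (w t x / W x) *\<^sub>R y t)" for x
  have w: "w t x \<ge> 0" for t x by (simp add: w_def)
  have W: "W x > 0" if "x \<in> S" for x
  proof -
    have "x \<in> (\<Union>t\<in>T. ball t (d t))" using T(3) that by blast
    then obtain t where "t \<in> T" "dist x t < d t" by (auto simp: dist_commute)
    then show ?thesis unfolding W_def
      by (intro sum_pos2[of _ t]) (use T w in \<open>auto simp: w_def\<close>)
  qed
  show ?thesis
  proof
    have "continuous_on S (w t)" for t
      unfolding w_def by (intro continuous_intros)
    moreover from this have "continuous_on S W"
      unfolding W_def by (intro continuous_intros)
    ultimately show "continuous_on S g"
      unfolding g_def using W by (intro continuous_intros) (auto dest: W)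
    fix x assume x: "x \<in> S"
    define N where "N = {z. \<exists>y\<in>\<Phi> x. dist z y < e}"
    have "N = (\<Union>a\<in>\<Phi> x. \<Union>b\<in>ball 0 e. {a + b})"
    proof (intro equalityI subsetI)
      fix z assume "z \<in> N"
      then obtain a where "a \<in> \<Phi> x" "z - a \<in> ball 0 e"
        by (auto simp: N_def dist_norm norm_minus_commute)
      moreover have "z = a + (z - a)" by simp
      ultimately show "z \<in> (\<Union>a\<in>\<Phi> x. \<Union>b\<in>ball 0 e. {a + b})" by blast
    qed (force simp: N_def dist_norm)
    then have N: "convex N" using convex_sums[OF conv[OF x] convex_ball] by metis
    \<comment> \<open>Only constants with positive weight at \<open>x\<close> are known to lie in
      \<open>N\<close>, so the others are dropped before convexity is applied.\<close>
    define T' where "T' = {t\<in>T. w t x > 0}"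
    have T': "w t x / W x = 0" if "t \<in> T - T'" for t
      using that w[of t x] by (auto simp: T'_def)
    have "g x = (\<Sum>t\<in>T'. (w t x / W x) *\<^sub>R y t)"
      unfolding g_def by (rule sum.mono_neutral_right) (use T T' in \<open>auto simp: T'_def\<close>)
    also have "\<dots> \<in> N"
    proof (rule convex_sum[OF _ N])
      have "(\<Sum>t\<in>T'. w t x / W x) = (\<Sum>t\<in>T. w t x / W x)"
        by (rule sum.mono_neutral_left) (use T T' in \<open>auto simp: T'_def\<close>)
      also have "\<dots> = 1"
        using W[OF x] by (simp add: sum_divide_distrib[symmetric] W_def)
      finally show "(\<Sum>t\<in>T'. w t x / W x) = 1" .
      show "y t \<in> N" if "t \<in> T'" for t
      proof -
        have "t \<in> S" "dist x t < d t" using that T by (auto simp: T'_def w_def)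
        then show ?thesis using yd[of t x] x by (auto simp: N_def dist_commute)
      qed
    qed (use T W[OF x] w in \<open>auto simp: T'_def\<close>)
    finally show "\<exists>y\<in>\<Phi> x. dist (g x) y < e" by (simp add: N_def)
  qed
qed

text \<open>Michael's iteration: each approximation is sought inside a shrinking ball around the
  previous one. The successive distances are summable, so the limit is uniform, and the errors tend
  to 0.\<close>

lemma closure_selection:
  fixes \<Phi> :: "'a::metric_space \<Rightarrow> 'b::banach set"
  assumes S: "compact S" and lsc: "lsc_map (top_of_set S) euclidean \<Phi>"
    and conv: "\<And>x. x \<in> S \<Longrightarrow> convex (\<Phi> x)" and ne: "\<And>x. x \<in> S \<Longrightarrow> \<Phi> x \<noteq> {}"
  obtains g where "continuous_on S g" "\<And>x. x \<in> S \<Longrightarrow> g x \<in> closure (\<Phi> x)"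
proof -
  define P where "P n g \<longleftrightarrow> continuous_on S g \<and> (\<forall>x\<in>S. \<exists>y\<in>\<Phi> x. dist (g x) y < (1/2)^n)"
    for n :: nat and g
  have "\<exists>g. \<forall>n. P n (g n) \<and> (\<forall>x\<in>S. dist (g n x) (g (Suc n) x) < 2 * (1/2)^n)"
  proof (rule dependent_nat_choice)
    show "\<exists>g. P 0 g"
      unfolding P_def by (rule approximate_selection[OF S lsc conv ne, of 1]) auto
    fix g n assume g: "P n g"
    \<comment> \<open>These values are nonempty because \<open>g\<close> has error less than
      \<open>(1/2)^n\<close>. Any approximate selection of them is therefore close to
      \<open>g\<close> as well as to \<open>\<Phi>\<close>.\<close>
    let ?\<Psi> = "\<lambda>x. \<Phi> x \<inter> ball (g x) ((1/2)^n)"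
    have "lsc_map (top_of_set S) euclidean ?\<Psi>"
      using lsc g by (intro lsc_map_Int_ball) (auto simp: P_def)
    moreover have "convex (?\<Psi> x)" if "x \<in> S" for x
      using conv[OF that] by (intro convex_Int convex_ball)
    moreover have "?\<Psi> x \<noteq> {}" if "x \<in> S" for x
      using g that unfolding P_def disjoint_iff by (auto simp: mem_ball)
    ultimately obtain h where h: "continuous_on S h"
      "\<And>x. x \<in> S \<Longrightarrow> \<exists>y\<in>?\<Psi> x. dist (h x) y < (1/2)^Suc n"
      by (rule approximate_selection[OF S, of ?\<Psi> "(1/2)^Suc n"]) auto
    have "dist (g x) (h x) < 2 * (1/2)^n" if x: "x \<in> S" for x
    proof -
      obtain y where "y \<in> ?\<Psi> x" "dist (h x) y < (1/2)^Suc n" using h(2)[OF x] by blast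
      then have "dist (g x) y < (1/2)^n" "dist (h x) y < (1/2)^n"
        using zero_le_dist[of "h x" y] by (simp, simp del: zero_le_dist)
      then show ?thesis using dist_triangle2[of "g x" "h x" y] by linarith
    qed
    then show "\<exists>h. P (Suc n) h \<and> (\<forall>x\<in>S. dist (g x) (h x) < 2 * (1/2)^n)"
      using h unfolding P_def by (intro exI[of _ h]) blast
  qed
  then obtain g where g: "\<And>n. P n (g n)"
    and step: "\<And>n x. x \<in> S \<Longrightarrow> dist (g n x) (g (Suc n) x) < 2 * (1/2)^n" by blast
  \<comment> \<open>The limit is written as a telescoping series so that the Weierstrass test yields
    uniform convergence.\<close>
  define l where "l x = (\<Sum>n. g (Suc n) x - g n x)" for x
  have "uniform_limit S (\<lambda>n x. \<Sum>i<n. g (Suc i) x - g i x) l sequentially"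
    unfolding l_def
  proof (rule Weierstrass_m_test)
    show "norm (g (Suc n) x - g n x) \<le> 2 * (1/2)^n" if "x \<in> S" for n x
      using step[OF that, of n] by (simp add: dist_norm norm_minus_commute)
    show "summable (\<lambda>n. 2 * (1/2::real)^n)" by (intro summable_mult summable_geometric) simp
  qed
  then have "uniform_limit S (\<lambda>n x. g 0 x + (\<Sum>i<n. g (Suc i) x - g i x)) (\<lambda>x. g 0 x + l x) sequentially"
    by (intro uniform_limit_intros)
  moreover have "(\<lambda>n x. g 0 x + (\<Sum>i<n. g (Suc i) x - g i x)) = g"
    by (intro ext) (simp add: sum_lessThan_telescope[where f="\<lambda>i. g i _"])
  ultimately have lim: "uniform_limit S g (\<lambda>x. g 0 x + l x) sequentially" by simp
  show ?thesis
  proof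
    show "continuous_on S (\<lambda>x. g 0 x + l x)"
      using g by (intro uniform_limit_theorem[OF _ lim]) (auto simp: P_def)
    fix x assume x: "x \<in> S"
    then have "\<forall>n. \<exists>y\<in>\<Phi> x. dist (g n x) y < (1/2)^n" using g by (auto simp: P_def)
    then obtain y where y: "\<And>n. y n \<in> \<Phi> x" "\<And>n. dist (g n x) (y n) < (1/2)^n" by metis
    have "(\<lambda>n. y n - g n x) \<longlonglongrightarrow> 0"
      by (rule Lim_null_comparison[where g="\<lambda>n. (1/2::real)^n"])
         (use y(2) in \<open>auto simp: dist_norm norm_minus_commute less_imp_le intro!: LIMSEQ_realpow_zero\<close>)
    from tendsto_add[OF this tendsto_uniform_limitI[OF lim x]]
    have "y \<longlonglongrightarrow> g 0 x + l x" by simp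
    then show "g 0 x + l x \<in> closure (\<Phi> x)"
      using y(1) closure_sequential by blast
  qed
qed

section \<open>Countable dense families of selections of the closures\<close>

text \<open>A selection can be forced close to a prescribed point \<open>q\<close> on a closed set
  over which all values meet a small ball around \<open>q\<close>. Countably many centres, radii and
  closed sets suffice to approach every point of every value.\<close>

lemma dense_closure_selections:
  fixes \<Phi> :: "'a::metric_space \<Rightarrow> 'b::{banach, second_countable_topology} set"
  assumes S: "compact S" and lsc: "lsc_map (top_of_set S) euclidean \<Phi>"
    and conv: "\<And>x. x \<in> S \<Longrightarrow> convex (\<Phi> x)" and ne: "\<And>x. x \<in> S \<Longrightarrow> \<Phi> x \<noteq> {}"
  obtains \<F> where "countable \<F>" "\<F> \<noteq> {}" "\<And>g. g \<in> \<F> \<Longrightarrow> continuous_on S g"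
    "\<And>g x. g \<in> \<F> \<Longrightarrow> x \<in> S \<Longrightarrow> g x \<in> closure (\<Phi> x)"
    "\<And>x. x \<in> S \<Longrightarrow> \<Phi> x \<subseteq> closure ((\<lambda>g. g x) ` \<F>)"
proof -
  obtain D :: "'b set" where D: "countable D" "\<And>U. open U \<Longrightarrow> U \<noteq> {} \<Longrightarrow> \<exists>q\<in>D. q \<in> U"
    using countable_dense_setE by blast
  define U where "U q n = {x \<in> S. \<Phi> x \<inter> ball q (1 / Suc n) \<noteq> {}}" for q n
  text \<open>For each \<open>q\<close> and \<open>n\<close> the sets \<open>A q n k\<close> are closed and exhaust the relatively open set
    \<open>U q n\<close>; on them the values of the map can be cut down to \<open>ball q (1 / Suc n)\<close>.\<close>
  define A where "A q n k = S - (\<Union>z\<in>S - U q n. ball z (1 / Suc k))" for q and n k :: nat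
  have "\<exists>g. continuous_on S g \<and> (\<forall>x\<in>S. g x \<in> closure (\<Phi> x)) \<and>
      (\<forall>x\<in>A q n k. dist q (g x) \<le> 1 / Suc n)" for q n k
  proof -
    have AU: "A q n k \<subseteq> U q n" unfolding A_def by force
    have cA: "closed (A q n k)"
      unfolding A_def using S by (intro closed_Diff compact_imp_closed open_UN) auto
    let ?\<Psi> = "\<lambda>x. if x \<in> A q n k then \<Phi> x \<inter> ball q (1 / Suc n) else \<Phi> x"
    have "lsc_map (top_of_set (A q n k)) euclidean (\<lambda>x. \<Phi> x \<inter> ball q (1 / Suc n))"
      by (intro lsc_map_Int_ball continuous_on_const lsc_map_subset[OF lsc]) (auto simp: A_def)
    then have "lsc_map (top_of_set S) euclidean ?\<Psi>"
      by (intro lsc_map_If_closed[OF lsc]) (use cA in auto)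
    moreover have "convex (?\<Psi> x)" if "x \<in> S" for x
      using conv[OF that] by (auto intro: convex_Int)
    moreover have "?\<Psi> x \<noteq> {}" if "x \<in> S" for x
      using ne[OF that] AU by (auto simp: U_def)
    ultimately obtain g where g: "continuous_on S g" "\<And>x. x \<in> S \<Longrightarrow> g x \<in> closure (?\<Psi> x)"
      by (rule closure_selection[OF S]) auto
    have "g x \<in> closure (\<Phi> x)" if "x \<in> S" for x
      using g(2)[OF that] closure_mono[of "?\<Psi> x" "\<Phi> x"] by (auto split: if_splits)
    moreover have "dist q (g x) \<le> 1 / Suc n" if "x \<in> A q n k" for x
    proof -
      have "x \<in> S" using that by (simp add: A_def)
      from g(2)[OF this] that have "g x \<in> closure (\<Phi> x \<inter> ball q (1 / Suc n))" by simp
      moreover have "closure (\<Phi> x \<inter> ball q (1 / Suc n)) \<subseteq> cball q (1 / Suc n)"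
        by (rule closure_minimal) auto
      ultimately show ?thesis by auto
    qed
    ultimately show ?thesis using g(1) by blast
  qed
  then obtain G where G: "\<And>q n k. continuous_on S (G q n k)"
    "\<And>q n k x. x \<in> S \<Longrightarrow> G q n k x \<in> closure (\<Phi> x)"
    "\<And>q n k x. x \<in> A q n k \<Longrightarrow> dist q (G q n k x) \<le> 1 / Suc n"
    by metis
  define \<F> where "\<F> = (\<lambda>(q, n, k). G q n k) ` (D \<times> UNIV \<times> UNIV)"
  show ?thesis
  proof
    show "countable \<F>" unfolding \<F>_def using D(1) by (intro countable_image countable_SIGMA) auto
    have "D \<noteq> {}" using D(2)[of UNIV] by auto
    then show "\<F> \<noteq> {}" by (auto simp: \<F>_def)
    show "continuous_on S g" if "g \<in> \<F>" for g using that G(1) by (auto simp: \<F>_def)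
    show "g x \<in> closure (\<Phi> x)" if "g \<in> \<F>" "x \<in> S" for g x using that G(2) by (auto simp: \<F>_def)
    fix x assume x: "x \<in> S"
    show "\<Phi> x \<subseteq> closure ((\<lambda>g. g x) ` \<F>)"
    proof
      fix y assume y: "y \<in> \<Phi> x"
      show "y \<in> closure ((\<lambda>g. g x) ` \<F>)"
        unfolding closure_approachable
      proof (intro allI impI)
        fix e :: real assume "e > 0"
        then obtain n where n: "1 / Suc n < e / 2"
          using reals_Archimedean[of "e / 2"] by (auto simp: inverse_eq_divide)
        obtain q where q: "q \<in> D" "dist y q < 1 / Suc n"
          using D(2)[of "ball y (1 / Suc n)"] by auto
        \<comment> \<open>Points closer to \<open>y\<close> than this margin lie in
          \<open>ball q (1 / Suc n)\<close>, so lower semicontinuity puts all points of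
          \<open>S\<close> near \<open>x\<close> in \<open>U q n\<close>.\<close>
        then have "1 / Suc n - dist y q > 0" by simp
        from lsc_mapD[OF lsc x y this] obtain d where d: "d > 0"
          "\<And>x'. x' \<in> S \<Longrightarrow> dist x' x < d \<Longrightarrow> \<exists>y'\<in>\<Phi> x'. dist y' y < 1 / Suc n - dist y q"
          by blast
        have near: "x' \<in> U q n" if x': "x' \<in> S" "dist x' x < d" for x'
        proof -
          obtain y' where y': "y' \<in> \<Phi> x'" "dist y' y < 1 / Suc n - dist y q" using d(2) x' by blast
          then have "dist q y' < 1 / Suc n"
            using dist_triangle[of q y' y] by (simp add: dist_commute)
          then show ?thesis using y'(1) x'(1) unfolding U_def by (auto simp: disjoint_iff)
        qed
        \<comment> \<open>Points of \<open>S - U q n\<close> are at distance at least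
          \<open>d\<close> from \<open>x\<close>, so a radius below \<open>d\<close> places
          \<open>x\<close> in \<open>A q n k\<close>.\<close>
        obtain k where k: "1 / Suc k < d"
          using reals_Archimedean[OF d(1)] by (auto simp: inverse_eq_divide)
        have "x \<in> A q n k"
        proof -
          have "dist z x \<ge> 1 / Suc k" if "z \<in> S - U q n" for z
            using near[of z] that k by force
          then show ?thesis using x unfolding A_def by (auto simp: not_less)
        qed
        from G(3)[OF this] have "dist (G q n k x) y < e"
          using n q(2) dist_triangle[of "G q n k x" y q] by (simp add: dist_commute)
        moreover have "G q n k \<in> \<F>" using q(1) unfolding \<F>_def by (intro image_eqI[of _ _ "(q, n, k)"]) auto
        ultimately show "\<exists>y'\<in>(\<lambda>g. g x) ` \<F>. dist y' y < e" by blast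
      qed
    qed
  qed
qed

section \<open>Averages in the relative interior, and exact selections\<close>

text \<open>Were \<open>p\<close> on the relative boundary, a hyperplane supporting \<open>S\<close>
  at \<open>p\<close> would contain every \<open>y i\<close>, hence by density all of
  \<open>S\<close>, although it misses the relative interior.\<close>

lemma sums_weighted_dense_in_rel_interior:
  fixes S :: "'a::euclidean_space set" and y :: "nat \<Rightarrow> 'a"
  assumes S: "convex S" "S \<noteq> {}" and y: "\<And>i. y i \<in> closure S" "S \<subseteq> closure (range y)"
    and w: "\<And>i. w i > 0" "w sums 1" and p: "(\<lambda>i. w i *\<^sub>R y i) sums p"
  shows "p \<in> rel_interior S"
proof -
  have inner: "(\<lambda>i. w i * (a \<bullet> y i - b)) sums (a \<bullet> p - b)" for a b
    using sums_diff[OF bounded_linear.sums[OF bounded_linear_inner_right p, of a] sums_mult2[OF w(2), of b]]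
    by (simp add: algebra_simps)
  text \<open>A half-space containing all \<open>y i\<close>, with \<open>p\<close> on its boundary, has all \<open>y i\<close> on its boundary.\<close>
  have eq: "a \<bullet> y i = b" if "\<And>i. a \<bullet> y i \<ge> b" "a \<bullet> p \<le> b" for a b i
  proof -
    have nonneg: "0 \<le> w i * (a \<bullet> y i - b)" for i using that(1)[of i] w(1)[of i] by simp
    then have "(\<Sum>i. w i * (a \<bullet> y i - b)) \<ge> 0"
      using inner[of a b] by (intro suminf_nonneg) (auto simp: sums_iff)
    then have "(\<Sum>i. w i * (a \<bullet> y i - b)) = 0"
      using inner[of a b] that(2) by (simp add: sums_iff)
    then have "w i * (a \<bullet> y i - b) = 0"
      using inner[of a b] nonneg by (subst (asm) suminf_eq_zero_iff) (auto simp: sums_iff)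
    then show ?thesis using w(1)[of i] by simp
  qed
  have pc: "p \<in> closure S"
  proof (rule ccontr)
    assume "p \<notin> closure S"
    then obtain a b where ab: "a \<bullet> p < b" "\<And>x. x \<in> closure S \<Longrightarrow> a \<bullet> x > b"
      using separating_hyperplane_closed_point[of "closure S" p] S by auto
    \<comment> \<open>Strict separation contradicts \<open>eq\<close>, whose conclusion would put
      \<open>y 0\<close> on the separating hyperplane.\<close>
    have "a \<bullet> y 0 = b" by (rule eq) (use ab y(1) in \<open>auto intro: less_imp_le\<close>)
    then show False using ab(2)[OF y(1)[of 0]] by simp
  qed
  show ?thesis
  proof (rule ccontr)
    assume "p \<notin> rel_interior S"
    \<comment> \<open>The support theorem is applied to \<open>closure S\<close>, which has the same
      relative interior as the convex set \<open>S\<close>.\<close>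
    then obtain a where a: "\<And>z. z \<in> closure S \<Longrightarrow> a \<bullet> p \<le> a \<bullet> z"
        "\<And>z. z \<in> rel_interior S \<Longrightarrow> a \<bullet> p < a \<bullet> z"
      using supporting_hyperplane_rel_boundary[of "closure S" p] pc S
      by (metis convex_closure convex_rel_interior_closure)
    have "range y \<subseteq> {z. a \<bullet> z = a \<bullet> p}"
      using eq[of "a \<bullet> p" a] a(1) y(1) by auto
    then have "closure (range y) \<subseteq> {z. a \<bullet> z = a \<bullet> p}"
      by (intro closure_minimal closed_hyperplane)
    moreover obtain z where "z \<in> rel_interior S" using S rel_interior_eq_empty by blast
    ultimately show False using a(2)[of z] y(2) rel_interior_subset[of S] by force
  qed
qed

text \<open>The relative interior is part of the value, so averaging a dense family of selections of
  the closures selects from the values themselves. Boundedness makes the weighted series converge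
  uniformly.\<close>

lemma convex_valued_selection:
  fixes \<Phi> :: "'a::metric_space \<Rightarrow> 'b::euclidean_space set"
  assumes S: "compact S" and lsc: "lsc_map (top_of_set S) euclidean \<Phi>"
    and conv: "\<And>x. x \<in> S \<Longrightarrow> convex (\<Phi> x)" and ne: "\<And>x. x \<in> S \<Longrightarrow> \<Phi> x \<noteq> {}"
    and bdd: "bounded (\<Union>x\<in>S. \<Phi> x)"
  obtains g where "continuous_on S g" "\<And>x. x \<in> S \<Longrightarrow> g x \<in> \<Phi> x"
proof -
  obtain \<F> where \<F>: "countable \<F>" "\<F> \<noteq> {}" "\<And>g. g \<in> \<F> \<Longrightarrow> continuous_on S g"
    "\<And>g x. g \<in> \<F> \<Longrightarrow> x \<in> S \<Longrightarrow> g x \<in> closure (\<Phi> x)"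
    "\<And>x. x \<in> S \<Longrightarrow> \<Phi> x \<subseteq> closure ((\<lambda>g. g x) ` \<F>)"
    by (rule dense_closure_selections[OF S lsc conv ne]) blast+
  \<comment> \<open>If \<open>\<F>\<close> is finite the enumeration repeats members, which harms
    neither density nor the positivity of the weights.\<close>
  define h where "h = from_nat_into \<F>"
  have h: "range h = \<F>" unfolding h_def using \<F>(1,2) by (rule range_from_nat_into[rotated])
  then have hF: "h i \<in> \<F>" for i by auto
  obtain B where "\<forall>z\<in>(\<Union>x\<in>S. \<Phi> x). norm z \<le> B"
    using bdd unfolding bounded_iff ..
  then have B: "(\<Union>x\<in>S. \<Phi> x) \<subseteq> cball 0 B" by auto
  have hB: "norm (h i x) \<le> B" if "x \<in> S" for i x
  proof -
    have "closure (\<Phi> x) \<subseteq> cball 0 B" using B that by (intro closure_minimal) auto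
    then show ?thesis using \<F>(4)[OF hF that] by force
  qed
  define w :: "nat \<Rightarrow> real" where "w i = (1/2)^Suc i" for i
  have w: "w i > 0" "w sums 1" for i
    using power_half_series by (simp_all add: w_def[abs_def])
  define g where "g x = (\<Sum>i. w i *\<^sub>R h i x)" for x
  have lim: "uniform_limit S (\<lambda>n x. \<Sum>i<n. w i *\<^sub>R h i x) g sequentially"
    unfolding g_def
  proof (rule Weierstrass_m_test)
    show "norm (w i *\<^sub>R h i x) \<le> w i * B" if "x \<in> S" for i x
      using hB[OF that] w(1)[of i] by (simp add: mult_left_mono)
    show "summable (\<lambda>i. w i * B)" using w(2) by (intro summable_mult2) (rule sums_summable)
  qed
  show ?thesis
  proof
    show "continuous_on S g"
      using \<F>(3)[OF hF] by (intro uniform_limit_theorem[OF _ lim] always_eventually allI continuous_intros) auto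
    fix x assume x: "x \<in> S"
    have "(\<lambda>i. w i *\<^sub>R h i x) sums g x"
      unfolding sums_def by (rule tendsto_uniform_limitI[OF lim x])
    moreover have "range (\<lambda>i. h i x) = (\<lambda>g. g x) ` \<F>" unfolding h[symmetric] by auto
    ultimately have "g x \<in> rel_interior (\<Phi> x)"
      using \<F>(4)[OF hF x] \<F>(5)[OF x] w
      by (intro sums_weighted_dense_in_rel_interior[OF conv[OF x] ne[OF x], of "\<lambda>i. h i x" w]) auto
    then show "g x \<in> \<Phi> x" using rel_interior_subset by blast
  qed
qed

section \<open>The quasiequilibrium problem\<close>

theorem theorem3p1:
  fixes C :: "(real ^ 'n) set"
    and f :: "real ^ 'n \<Rightarrow> real ^ 'n \<Rightarrow> real"
    and K :: "real ^ 'n \<Rightarrow> (real ^ 'n) set"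
  assumes "C \<noteq> {}" and "convex C" and "compact C"
    and "\<And>x. x \<in> C \<Longrightarrow> f x x = 0"
    and "\<And>x. x \<in> C \<Longrightarrow> K x \<subseteq> C"
    and "lsc_map (top_of_set C) (top_of_set C) K"
    and "\<And>x. x \<in> C \<Longrightarrow> K x \<noteq> {}"
    and "\<And>x. x \<in> C \<Longrightarrow> convex (K x)"
    and "closed (fix_set C K)"
    and "\<And>x. x \<in> fix_set C K \<Longrightarrow> convex (neg_set C f x)"
    and "lsc_map_on (top_of_set C) (top_of_set C) (neg_set C f) (fix_set C K)"
    and "lsc_map_on (top_of_set C) (top_of_set C) (\<lambda>x. neg_set C f x \<inter> K x)
           (top_of_set C frontier_of fix_set C K)"
  shows "\<exists>x\<in>C. x \<in> K x \<and> (\<forall>y\<in>K x. f x y \<ge> 0)"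
proof (rule ccontr)
  assume no_sol: "\<not> ?thesis"
  define X where "X = fix_set C K"
  define D where "D = top_of_set C frontier_of X"
  define F where "F = neg_set C f"
  have XC: "X \<subseteq> C" by (auto simp: X_def fix_set_def)
  have FC: "F x \<subseteq> C" for x by (auto simp: F_def neg_set_def)
  have cX: "closed X" using assms(9) by (simp add: X_def)
  \<comment> \<open>Closedness of \<open>X\<close> identifies its relative boundary with the set on
    which gluing along \<open>X\<close> requires an inclusion of values.\<close>
  have D: "D = X \<inter> closure (C - X)"
  proof -
    have "D = (C \<inter> closure (C \<inter> X)) \<inter> (C \<inter> closure (C \<inter> (C - X)))"
      unfolding D_def frontier_of_closures closure_of_subtopology
      by (simp add: closure_of_subtopology)
    also have "\<dots> = X \<inter> closure (C - X)"
      using XC cX by (auto simp: Int_absorb1 Int_absorb2)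
    finally show ?thesis .
  qed
  have DX: "D \<subseteq> X" and cD: "closed D" using cX by (auto simp: D)
  have lsc_euclidean: "lsc_map (top_of_set T) euclidean \<Phi>"
    if "lsc_map (top_of_set T) (top_of_set C) \<Phi>" "\<And>x. x \<in> T \<Longrightarrow> \<Phi> x \<subseteq> C"
    for T :: "(real ^ 'n) set" and \<Phi> :: "real ^ 'n \<Rightarrow> (real ^ 'n) set"
    using that lsc_map_top_of_set_iff[of T \<Phi> C] lsc_map_iff[of T \<Phi>] by simp
  have lK: "lsc_map (top_of_set C) euclidean K"
    using assms(5,6) by (intro lsc_euclidean)
  have lF: "lsc_map (top_of_set X) euclidean F"
    using assms(11) XC FC
    by (intro lsc_euclidean) (auto simp: lsc_map_on_def subtopology_subtopology Int_absorb1 X_def F_def)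
  have lFK: "lsc_map (top_of_set D) euclidean (\<lambda>x. F x \<inter> K x)"
  proof (rule lsc_euclidean)
    have "C \<inter> D = D" using DX XC by auto
    then show "lsc_map (top_of_set D) (top_of_set C) (\<lambda>x. F x \<inter> K x)"
      using assms(12) by (simp add: lsc_map_on_def subtopology_subtopology D_def X_def F_def)
  qed (use FC in auto)
  define H where "H x = (if x \<in> D then F x \<inter> K x else F x)" for x
  define G where "G x = (if x \<in> X then H x else K x)" for x
  \<comment> \<open>The map is glued in two stages. Along \<open>D\<close> the inclusion is
    \<open>F x \<inter> K x \<subseteq> F x\<close>; along \<open>X\<close> it is needed only on
    \<open>D\<close>, where \<open>H x = F x \<inter> K x\<close> lies in
    \<open>K x\<close>.\<close>
  have "lsc_map (top_of_set X) euclidean H"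
    unfolding H_def using lsc_map_If_closed[OF lF lFK cD] by auto
  then have lG: "lsc_map (top_of_set C) euclidean G"
    unfolding G_def by (rule lsc_map_If_closed[OF lK _ cX]) (auto simp: D H_def)
  \<comment> \<open>Here the assumed absence of solutions enters: it gives nonempty values on all of
    \<open>X\<close>, both for \<open>F\<close> and for its intersection with
    \<open>K\<close>.\<close>
  have FK_ne: "F x \<inter> K x \<noteq> {}" if "x \<in> X" for x
  proof -
    have "x \<in> C" "x \<in> K x" using that by (auto simp: X_def fix_set_def)
    then obtain y where "y \<in> K x" "f x y < 0" using no_sol by (auto simp: not_le)
    then show ?thesis using assms(5)[OF \<open>x \<in> C\<close>] by (auto simp: F_def neg_set_def)
  qed
  have GC: "G x \<subseteq> C" if "x \<in> C" for x
    using assms(5)[OF that] FC by (auto simp: G_def H_def)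
  have "convex (G x)" if "x \<in> C" for x
    using that assms(8,10) by (auto simp: G_def H_def F_def X_def intro: convex_Int)
  moreover have "G x \<noteq> {}" if "x \<in> C" for x
    using that assms(7) FK_ne[of x] by (auto simp: G_def H_def)
  moreover have "bounded (\<Union>x\<in>C. G x)"
    using GC by (intro bounded_subset[OF compact_imp_bounded[OF assms(3)]]) auto
  ultimately obtain g where g: "continuous_on C g" "\<And>x. x \<in> C \<Longrightarrow> g x \<in> G x"
    by (rule convex_valued_selection[OF assms(3) lG]) blast+
  have "g \<in> C \<rightarrow> C" using g(2) GC by blast
  then obtain x where x: "x \<in> C" "g x = x"
    using brouwer[OF assms(3,2,1) g(1)] by blast
  \<comment> \<open>On \<open>X\<close> this would give \<open>x \<in> F x\<close>; off
    \<open>X\<close> it gives \<open>x \<in> K x\<close>, which puts \<open>x\<close> in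
    \<open>X\<close>.\<close>
  then have "x \<in> G x" using g(2) by metis
  moreover have "x \<notin> F x" using assms(4)[OF x(1)] by (simp add: F_def neg_set_def)
  ultimately show False
    using x(1) by (auto simp: G_def H_def X_def fix_set_def split: if_splits)
qed

end
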